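(* Fix a finite alphabet $\mathfrak{n}=\{0,1,\dots,\mathfrak{n}-1\}$ with $\mathfrak{n}\ge 2$. The topological conjugacy relation on the standard Borel space $\mathcal{T}^{*}_{\mathfrak{n}}$ of Toeplitz subshifts over $\mathfrak{n}$ with separated holes is hyperfinite.
   Context: The left shift $\sigma:\mathfrak{n}^{\mathbb{Z}}\to\mathfrak{n}^{\mathbb{Z}}$ is $(\sigma(\alpha))(i)=\alpha(i+1)$. A subshift is an infinite closed subset $O\subseteq\mathfrak{n}^{\mathbb{Z}}$ with $\sigma[O]=O$; two subshifts $O,O'$ are topologically conjugate if there is a homeomorphism $\pi:O\to O'$ with $\pi\circ\sigma=\sigma\circ\pi$. For $\alpha\in\mathfrak{n}^{\mathbb{Z}}$ and $p\in\mathbb{N}^+$, let $Per_p(\alpha)=\{i\in\mathbb{Z}:\forall k\in\mathbb{Z}\ \alpha(i+pk)=\alpha(i)\}$; $p$ is a period of $\alpha$ if $Per_p(\alpha)\neq\emptyset$, and an essential period if moreover $Per_p(\alpha)\neq Per_q(\alpha)$ for all $q<p$. A Toeplitz sequence is a non-periodic $\alpha\in\mathfrak{n}^{\mathbb{Z}}$ with $\bigcup_{p\in\mathbb{N}^+}Per_p(\alpha)=\mathbb{Z}$; a Toeplitz subshift is the closure of the $\sigma$-orbit of a Toeplitz sequence. All points of a Toeplitz subshift $O$ have the same essential periods. A supernatural number is a formal product $\prod_{i\ge1}\mathrm{p}_i^{k_i}$ ($\mathrm{p}_i$ the $i$-th prime, $k_i\in\mathbb{N}\cup\{\infty\}$);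 for a sequence $(u_i)$ of positive integers, $\mathrm{lcm}(u_i)$ is the supernatural number with $k_i=\sup\{j:\exists m\ \mathrm{p}_i^j\mid u_m\}$. The scale of $O$ is the lcm of the essential periods of some (any) point of $O$. A factorization of a supernatural number $\mathbf{u}$ is a sequence $(u_i)$ with $u_i\mid u_{i+1}$ and $\mathrm{lcm}(u_i)=\mathbf{u}$. The $u_i$-holes of $\alpha$ are the indices in $\mathbb{Z}\setminus Per_{u_i}(\alpha)$. A Toeplitz subshift $O$ has separated holes if, for a factorization $(u_i)$ of its scale, the minimal distance between distinct $u_i$-holes of some (equivalently every) element of $O$ tends to infinity as $i\to\infty$ (this is independent of the factorization). $\mathcal{T}^{*}_{\mathfrak{n}}$ is the set of such subshifts, a Borel subset of the hyperspace $K(\mathfrak{n}^{\mathbb{Z}})$ of nonempty compact subsets with the Hausdorff metric topology, with the induced standard Borel structure. *)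

theory Defs
  imports "HOL-Analysis.Analysis"
begin

section \<open>The full shift\<close>

text \<open>
  The alphabet is \<open>{0, \<dots>, n - 1}\<close>, so \<open>full_shift n\<close> is a closed subset of the type
  \<open>int \<Rightarrow> nat\<close>, whose topology is the product of the discrete topologies. Closures, compactness and
  homeomorphisms of subsets of the full shift can therefore be taken in that type.
\<close>

definition full_shift :: "nat \<Rightarrow> (int \<Rightarrow> nat) set" where
  "full_shift n = {\<alpha>. \<forall>i. \<alpha> i < n}"

definition shift :: "(int \<Rightarrow> nat) \<Rightarrow> int \<Rightarrow> nat" where
  "shift \<alpha> = (\<lambda>i. \<alpha> (i + 1))"

text \<open>The two-sided orbit: the \<open>k\<close>-th iterate of the shift, for \<open>k \<in> \<int>\<close>, translates by \<open>k\<close>.\<close>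

definition shift_orbit :: "(int \<Rightarrow> nat) \<Rightarrow> (int \<Rightarrow> nat) set" where
  "shift_orbit \<alpha> = range (\<lambda>k::int. \<lambda>i. \<alpha> (i + k))"

definition topologically_conjugate :: "(int \<Rightarrow> nat) set \<Rightarrow> (int \<Rightarrow> nat) set \<Rightarrow> bool" where
  "topologically_conjugate X Y \<longleftrightarrow>
     (\<exists>\<pi> \<rho>. homeomorphism X Y \<pi> \<rho> \<and> (\<forall>x\<in>X. \<pi> (shift x) = shift (\<pi> x)))"

section \<open>Toeplitz subshifts\<close>

definition Per :: "nat \<Rightarrow> (int \<Rightarrow> nat) \<Rightarrow> int set" where
  "Per p \<alpha> = {i. \<forall>k. \<alpha> (i + int p * k) = \<alpha> i}"

definition essential_period :: "(int \<Rightarrow> nat) \<Rightarrow> nat \<Rightarrow> bool" where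
  "essential_period \<alpha> p \<longleftrightarrow>
     0 < p \<and> Per p \<alpha> \<noteq> {} \<and> (\<forall>q. 0 < q \<and> q < p \<longrightarrow> Per p \<alpha> \<noteq> Per q \<alpha>)"

definition periodic :: "(int \<Rightarrow> nat) \<Rightarrow> bool" where
  "periodic \<alpha> \<longleftrightarrow> (\<exists>p::nat. 0 < p \<and> (\<forall>i. \<alpha> (i + int p) = \<alpha> i))"

definition toeplitz_sequence :: "nat \<Rightarrow> (int \<Rightarrow> nat) \<Rightarrow> bool" where
  "toeplitz_sequence n \<alpha> \<longleftrightarrow>
     \<alpha> \<in> full_shift n \<and> \<not> periodic \<alpha> \<and> (\<Union>p\<in>{0<..}. Per p \<alpha>) = UNIV"

definition toeplitz_subshift :: "nat \<Rightarrow> (int \<Rightarrow> nat) set \<Rightarrow> bool" where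
  "toeplitz_subshift n X \<longleftrightarrow> (\<exists>\<alpha>. toeplitz_sequence n \<alpha> \<and> X = closure (shift_orbit \<alpha>))"

section \<open>Scale and separated holes\<close>

text \<open>
  A supernatural number is given by its exponents, indexed by the primes themselves; the value at
  a non-prime is irrelevant and is 0 for everything constructed below.
\<close>

type_synonym supernatural = "nat \<Rightarrow> enat"

definition supernatural_lcm :: "nat set \<Rightarrow> supernatural" where
  "supernatural_lcm U =
     (\<lambda>q. if prime q then (SUP j\<in>{j. \<exists>m\<in>U. q ^ j dvd m}. enat j) else 0)"

definition scale :: "(int \<Rightarrow> nat) set \<Rightarrow> supernatural" where
  "scale X = supernatural_lcm {p. essential_period (SOME \<alpha>. \<alpha> \<in> X) p}"

definition factorization :: "supernatural \<Rightarrow> (nat \<Rightarrow> nat) \<Rightarrow> bool" where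
  "factorization s u \<longleftrightarrow>
     (\<forall>i. 0 < u i) \<and> (\<forall>i. u i dvd u (Suc i)) \<and> supernatural_lcm (range u) = s"

definition holes :: "nat \<Rightarrow> (int \<Rightarrow> nat) \<Rightarrow> int set" where
  "holes p \<alpha> = - Per p \<alpha>"

definition hole_gap :: "nat \<Rightarrow> (int \<Rightarrow> nat) \<Rightarrow> enat" where
  "hole_gap p \<alpha> = Inf {enat (nat \<bar>i - j\<bar>) | i j. i \<in> holes p \<alpha> \<and> j \<in> holes p \<alpha> \<and> i \<noteq> j}"

definition separated_holes :: "(int \<Rightarrow> nat) set \<Rightarrow> bool" where
  "separated_holes X \<longleftrightarrow>
     (\<exists>u. factorization (scale X) u \<and> (\<exists>\<alpha>\<in>X. (\<lambda>i. hole_gap (u i) \<alpha>) \<longlonglongrightarrow> \<infinity>))"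

definition toeplitz_separated :: "nat \<Rightarrow> (int \<Rightarrow> nat) set set" where
  "toeplitz_separated n = {X. toeplitz_subshift n X \<and> separated_holes X}"

definition conjugacy_rel :: "nat \<Rightarrow> ((int \<Rightarrow> nat) set \<times> (int \<Rightarrow> nat) set) set" where
  "conjugacy_rel n =
     {(X, Y). X \<in> toeplitz_separated n \<and> Y \<in> toeplitz_separated n \<and> topologically_conjugate X Y}"

section \<open>The hyperspace of nonempty compact sets\<close>

definition hyperspace :: "nat \<Rightarrow> (int \<Rightarrow> nat) set set" where
  "hyperspace n = {X. X \<subseteq> full_shift n \<and> X \<noteq> {} \<and> compact X}"

text \<open>
  A compatible metric on the sequence space (see \<open>mtopology_seq_dist\<close> below): distinct sequences that
  first differ at distance \<open>k\<close> from the origin have distance \<open>2\<^sup>-\<^sup>k\<close>.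
\<close>

definition seq_dist :: "(int \<Rightarrow> nat) \<Rightarrow> (int \<Rightarrow> nat) \<Rightarrow> real" where
  "seq_dist \<alpha> \<beta> =
     (if \<alpha> = \<beta> then 0 else (1/2) ^ (LEAST k. \<exists>i. nat \<bar>i\<bar> = k \<and> \<alpha> i \<noteq> \<beta> i))"

text \<open>
  The value 0 for an empty argument is junk; it is there because \<open>Metric_space\<close> asks for
  nonnegativity also outside the carrier. All infima and suprema are of sets bounded by 0 and 1.
\<close>

definition hausdorff_distance :: "(int \<Rightarrow> nat) set \<Rightarrow> (int \<Rightarrow> nat) set \<Rightarrow> real" where
  "hausdorff_distance X Y =
     (if X = {} \<or> Y = {} then 0
      else max (SUP x\<in>X. INF y\<in>Y. seq_dist x y) (SUP y\<in>Y. INF x\<in>X. seq_dist x y))"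

definition hyperspace_topology :: "nat \<Rightarrow> (int \<Rightarrow> nat) set topology" where
  "hyperspace_topology n = Metric_space.mtopology (hyperspace n) hausdorff_distance"

definition hyperspace_borel :: "nat \<Rightarrow> (int \<Rightarrow> nat) set measure" where
  "hyperspace_borel n = sigma (hyperspace n) {U. openin (hyperspace_topology n) U}"

lemma seq_dist_le_iff: "seq_dist \<alpha> \<beta> \<le> (1/2) ^ k \<longleftrightarrow> (\<forall>i. \<bar>i\<bar> < int k \<longrightarrow> \<alpha> i = \<beta> i)"
proof (cases "\<alpha> = \<beta>")
  case False
  define P where "P = (\<lambda>k. \<exists>i. nat \<bar>i\<bar> = k \<and> \<alpha> i \<noteq> \<beta> i)"
  from False obtain j where "\<alpha> j \<noteq> \<beta> j" by auto
  then have "P (nat \<bar>j\<bar>)" by (auto simp: P_def)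
  then have P: "P (Least P)" by (rule LeastI)
  have "seq_dist \<alpha> \<beta> = (1/2) ^ Least P" using False by (simp add: seq_dist_def P_def)
  then have "seq_dist \<alpha> \<beta> \<le> (1/2) ^ k \<longleftrightarrow> k \<le> Least P"
    by simp
  also have "\<dots> \<longleftrightarrow> (\<forall>l. P l \<longrightarrow> k \<le> l)"
    using P Least_le[of P] by (meson order_trans)
  also have "\<dots> \<longleftrightarrow> (\<forall>i. \<bar>i\<bar> < int k \<longrightarrow> \<alpha> i = \<beta> i)"
    by (auto simp: P_def not_less[symmetric] nat_less_iff)
  finally show ?thesis .
qed (simp add: seq_dist_def)

lemma seq_dist_nonneg: "0 \<le> seq_dist \<alpha> \<beta>"
  by (simp add: seq_dist_def)

lemma seq_dist_le_1: "seq_dist \<alpha> \<beta> \<le> 1"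
  using seq_dist_le_iff[of \<alpha> \<beta> 0] by simp

lemma seq_dist_commute: "seq_dist \<alpha> \<beta> = seq_dist \<beta> \<alpha>"
proof -
  have "(\<lambda>k. \<exists>i. nat \<bar>i\<bar> = k \<and> \<alpha> i \<noteq> \<beta> i) = (\<lambda>k. \<exists>i. nat \<bar>i\<bar> = k \<and> \<beta> i \<noteq> \<alpha> i)"
    by metis
  then show ?thesis by (auto simp: seq_dist_def)
qed

lemma seq_dist_cases: "seq_dist \<alpha> \<beta> = 0 \<and> \<alpha> = \<beta> \<or> (\<exists>k. seq_dist \<alpha> \<beta> = (1/2) ^ k)"
  by (auto simp: seq_dist_def)

lemma seq_dist_ultra: "seq_dist \<alpha> \<gamma> \<le> max (seq_dist \<alpha> \<beta>) (seq_dist \<beta> \<gamma>)"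
proof (cases "\<alpha> = \<beta> \<or> \<beta> = \<gamma>")
  case False
  then obtain k l where "seq_dist \<alpha> \<beta> = (1/2) ^ k" "seq_dist \<beta> \<gamma> = (1/2) ^ l"
    using seq_dist_cases[of \<alpha> \<beta>] seq_dist_cases[of \<beta> \<gamma>] by auto
  then obtain m where **: "max (seq_dist \<alpha> \<beta>) (seq_dist \<beta> \<gamma>) = (1/2) ^ m"
    by (metis max_def)
  then have *: "seq_dist \<alpha> \<beta> \<le> (1/2) ^ m" "seq_dist \<beta> \<gamma> \<le> (1/2) ^ m"
    by (simp_all flip: **)
  from * have "seq_dist \<alpha> \<gamma> \<le> (1/2) ^ m" unfolding seq_dist_le_iff by simp
  with ** show ?thesis by simp
qed auto

lemma Metric_space_seq_dist: "Metric_space UNIV seq_dist"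
proof
  show "seq_dist x y = 0 \<longleftrightarrow> x = y" for x y by (simp add: seq_dist_def)
  show "seq_dist x z \<le> seq_dist x y + seq_dist y z" for x y z
    using seq_dist_ultra[of x z y] seq_dist_nonneg[of x y] seq_dist_nonneg[of y z] by linarith
  show "0 \<le> seq_dist x y" for x y by (rule seq_dist_nonneg)
  show "seq_dist x y = seq_dist y x" for x y by (rule seq_dist_commute)
qed

lemma mtopology_seq_dist: "Metric_space.mtopology UNIV seq_dist = euclidean"
proof -
  interpret M: Metric_space UNIV seq_dist by (rule Metric_space_seq_dist)
  have "open U \<longleftrightarrow> (\<forall>x\<in>U. \<exists>r>0. M.mball x r \<subseteq> U)" for U
  proof
    assume U: "open U"
    show "\<forall>x\<in>U. \<exists>r>0. M.mball x r \<subseteq> U"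
    proof
      fix x assume "x \<in> U"
      then obtain X where X: "x \<in> (\<Pi>\<^sub>E i\<in>UNIV. X i)" "finite {i. X i \<noteq> UNIV}"
          "(\<Pi>\<^sub>E i\<in>UNIV. X i) \<subseteq> U"
        using product_topology_open_contains_basis[of "\<lambda>_. euclidean" UNIV U x] U
        by (auto simp: open_fun_def)
      define k where "k = Suc (nat (\<Sum>i | X i \<noteq> UNIV. \<bar>i\<bar>))"
      have k: "\<bar>i\<bar> < int k" if "X i \<noteq> UNIV" for i
        using member_le_sum[of i "{i. X i \<noteq> UNIV}" abs] X(2) that by (auto simp: k_def)
      have "M.mball x ((1/2) ^ k) \<subseteq> U"
      proof
        fix y assume "y \<in> M.mball x ((1/2) ^ k)"
        then have "seq_dist x y \<le> (1/2) ^ k" by auto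
        then have "y i = x i" if "X i \<noteq> UNIV" for i
          using k[OF that] by (auto simp: seq_dist_le_iff)
        then have "y \<in> (\<Pi>\<^sub>E i\<in>UNIV. X i)" using X(1) by (fastforce simp: PiE_iff)
        with X(3) show "y \<in> U" by auto
      qed
      then show "\<exists>r>0. M.mball x r \<subseteq> U" by (intro exI[of _ "(1/2) ^ k"]) auto
    qed
  next
    assume *: "\<forall>x\<in>U. \<exists>r>0. M.mball x r \<subseteq> U"
    show "open U"
    proof (subst open_subopen, intro ballI)
      fix x assume "x \<in> U"
      with * obtain r where r: "r > 0" "M.mball x r \<subseteq> U" by auto
      obtain k where k: "(1/2::real) ^ k < r"
        using real_arch_pow_inv[OF r(1), of "1/2"] by auto
      define T where "T = (\<Inter>i\<in>{- int k..int k}. (\<lambda>y. y i) -` {x i})"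
      have "open T"
        unfolding T_def
        by (intro open_INT ballI open_vimage continuous_on_product_coordinates open_discrete) auto
      moreover have "T \<subseteq> U"
      proof
        fix y assume "y \<in> T"
        then have "y i = x i" if "\<bar>i\<bar> < int k" for i
          using that \<open>y \<in> T\<close> by (simp add: T_def abs_less_iff)
        then have "seq_dist x y \<le> (1/2) ^ k" by (simp add: seq_dist_le_iff)
        with k r(2) show "y \<in> U" by auto
      qed
      ultimately show "\<exists>T. open T \<and> x \<in> T \<and> T \<subseteq> U" by (auto simp: T_def)
    qed
  qed
  then show ?thesis
    unfolding topology_eq M.openin_mtopology by (simp add: Ball_def)
qed

lemma compact_seq_imp_closed: "compact X \<Longrightarrow> closed X" for X :: "(int \<Rightarrow> nat) set"
  using compactin_imp_closedin[of euclidean X]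
    Metric_space.Hausdorff_space_mtopology[OF Metric_space_seq_dist]
  by (simp add: mtopology_seq_dist)

lemma INF_seq_dist_le: "y \<in> Y \<Longrightarrow> (INF y\<in>Y. seq_dist x y) \<le> seq_dist x y"
  by (intro cINF_lower bdd_belowI2[where m = 0] seq_dist_nonneg)

lemma hausdorff_distance_commute: "hausdorff_distance X Y = hausdorff_distance Y X"
proof -
  have "(SUP x\<in>A. INF y\<in>B. seq_dist x y) = (SUP x\<in>A. INF y\<in>B. seq_dist y x)" for A B
    by (intro SUP_cong INF_cong refl seq_dist_commute)
  then show ?thesis by (auto simp: hausdorff_distance_def max.commute)
qed

lemma INF_le_hausdorff_distance:
  assumes "x \<in> X" "Y \<noteq> {}"
  shows "(INF y\<in>Y. seq_dist x y) \<le> hausdorff_distance X Y"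
proof -
  obtain y where y: "y \<in> Y" using assms by auto
  have "(INF y\<in>Y. seq_dist x y) \<le> 1" for x
    using INF_seq_dist_le[OF y, of x] seq_dist_le_1[of x y] by linarith
  then have "(INF y\<in>Y. seq_dist x y) \<le> (SUP x\<in>X. INF y\<in>Y. seq_dist x y)"
    using assms by (intro cSUP_upper bdd_aboveI2) auto
  then show ?thesis using assms by (auto simp: hausdorff_distance_def)
qed

lemma INF_triangle_hausdorff:
  assumes "X \<noteq> {}" "Y \<noteq> {}" "Z \<noteq> {}" "x \<in> X"
  shows "(INF z\<in>Z. seq_dist x z) \<le> hausdorff_distance X Y + hausdorff_distance Y Z"
proof -
  interpret M: Metric_space UNIV seq_dist by (rule Metric_space_seq_dist)
  have "(INF z\<in>Z. seq_dist x z) - hausdorff_distance Y Z \<le> seq_dist x y" if "y \<in> Y" for y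
  proof -
    have "(INF z\<in>Z. seq_dist x z) - seq_dist x y \<le> seq_dist y z" if "z \<in> Z" for z
      using INF_seq_dist_le[OF that, of x] M.triangle[of x y z] by simp
    then have "(INF z\<in>Z. seq_dist x z) - seq_dist x y \<le> (INF z\<in>Z. seq_dist y z)"
      using assms by (intro cINF_greatest) auto
    then show ?thesis using INF_le_hausdorff_distance[OF that assms(3)] by linarith
  qed
  then have "(INF z\<in>Z. seq_dist x z) - hausdorff_distance Y Z \<le> (INF y\<in>Y. seq_dist x y)"
    using assms by (intro cINF_greatest) auto
  then show ?thesis
    using INF_le_hausdorff_distance[OF assms(4,2)] by linarith
qed

lemma Metric_space_hyperspace: "Metric_space (hyperspace n) hausdorff_distance"
proof
  show "0 \<le> hausdorff_distance X Y" for X Y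
  proof (cases "X = {} \<or> Y = {}")
    case False
    then obtain x where x: "x \<in> X" by auto
    have "0 \<le> (INF y\<in>Y. seq_dist x y)"
      using False by (intro cINF_greatest seq_dist_nonneg) auto
    with x False INF_le_hausdorff_distance[of x X Y] show ?thesis by linarith
  qed (simp add: hausdorff_distance_def)
next
  show "hausdorff_distance X Y = hausdorff_distance Y X" for X Y
    by (rule hausdorff_distance_commute)
next
  interpret M: Metric_space UNIV seq_dist by (rule Metric_space_seq_dist)
  fix X Y assume X: "X \<in> hyperspace n" and Y: "Y \<in> hyperspace n"
  have sub: "A \<subseteq> B"
    if "hausdorff_distance A B = 0" "A \<in> hyperspace n" "B \<in> hyperspace n" for A B
  proof
    fix x assume "x \<in> A"
    have "closed B" "B \<noteq> {}" using that by (auto simp: hyperspace_def compact_seq_imp_closed)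
    have le: "(INF y\<in>B. seq_dist x y) \<le> 0"
      using INF_le_hausdorff_distance[OF \<open>x \<in> A\<close> \<open>B \<noteq> {}\<close>] that(1) by simp
    show "x \<in> B"
    proof (rule ccontr)
      assume "x \<notin> B"
      moreover have "openin M.mtopology (- B)"
        using \<open>closed B\<close> by (simp add: mtopology_seq_dist open_Compl)
      ultimately obtain r where r: "r > 0" "M.mball x r \<subseteq> - B"
        unfolding M.openin_mtopology by blast
      have "r \<le> seq_dist x y" if "y \<in> B" for y
        using r(2) that by (force simp: subset_eq)
      then have "r \<le> (INF y\<in>B. seq_dist x y)"
        using \<open>B \<noteq> {}\<close> by (intro cINF_greatest)
      with le r(1) show False by simp
    qed
  qed
  have *: "(INF y\<in>X. seq_dist x y) = 0" if "x \<in> X" for x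
  proof (rule antisym)
    show "(INF y\<in>X. seq_dist x y) \<le> 0"
      using INF_seq_dist_le[OF that, of x] by simp
    show "0 \<le> (INF y\<in>X. seq_dist x y)"
      using that by (intro cINF_greatest seq_dist_nonneg) auto
  qed
  then have "(INF x\<in>X. seq_dist x y) = 0" if "y \<in> X" for y
    using that by (subst seq_dist_commute) simp
  with * have "hausdorff_distance X X = 0"
    by (simp add: hausdorff_distance_def)
  then show "hausdorff_distance X Y = 0 \<longleftrightarrow> X = Y"
    using sub[OF _ X Y] sub[OF _ Y X] hausdorff_distance_commute[of X Y] by auto
next
  fix X Y Z assume "X \<in> hyperspace n" "Y \<in> hyperspace n" "Z \<in> hyperspace n"
  then have ne: "X \<noteq> {}" "Y \<noteq> {}" "Z \<noteq> {}" by (auto simp: hyperspace_def)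
  have "(SUP x\<in>X. INF z\<in>Z. seq_dist x z) \<le> hausdorff_distance X Y + hausdorff_distance Y Z"
    using ne by (intro cSUP_least INF_triangle_hausdorff) auto
  moreover have "(SUP z\<in>Z. INF x\<in>X. seq_dist x z) \<le> hausdorff_distance X Y + hausdorff_distance Y Z"
  proof (intro cSUP_least ne)
    fix z assume "z \<in> Z"
    from INF_triangle_hausdorff[OF ne(3,2,1) this]
    show "(INF x\<in>X. seq_dist x z) \<le> hausdorff_distance X Y + hausdorff_distance Y Z"
      by (simp add: seq_dist_commute[of z] hausdorff_distance_commute[of Z]
          hausdorff_distance_commute[of Y X])
  qed
  ultimately show "hausdorff_distance X Z \<le> hausdorff_distance X Y + hausdorff_distance Y Z"
    using ne by (subst hausdorff_distance_def) auto
qed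

lemma compact_full_shift: "compact (full_shift n)"
proof -
  have "full_shift n = Pi UNIV (\<lambda>_. {..<n})" by (auto simp: full_shift_def)
  moreover have "compactin (product_topology (\<lambda>_. euclidean) UNIV) (Pi\<^sub>E (UNIV::int set) (\<lambda>_. {..<n}))"
    by (subst compactin_PiE) (auto simp: finite_imp_compact)
  ultimately show ?thesis
    by (simp add: euclidean_product_topology PiE_UNIV_domain)
qed

lemma toeplitz_separated_subset_hyperspace: "toeplitz_separated n \<subseteq> hyperspace n"
proof
  fix X assume "X \<in> toeplitz_separated n"
  then obtain \<alpha> where \<alpha>: "\<alpha> \<in> full_shift n" "X = closure (shift_orbit \<alpha>)"
    by (auto simp: toeplitz_separated_def toeplitz_subshift_def toeplitz_sequence_def)
  have "shift_orbit \<alpha> \<subseteq> full_shift n" "shift_orbit \<alpha> \<noteq> {}"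
    using \<alpha>(1) by (auto simp: shift_orbit_def full_shift_def)
  then have "X \<subseteq> full_shift n" "X \<noteq> {}"
    using \<alpha>(2) closure_minimal[OF _ compact_seq_imp_closed[OF compact_full_shift]] by auto
  moreover have "compact X"
    using \<open>X \<subseteq> full_shift n\<close> \<alpha>(2) compact_full_shift
    by (metis closed_closure compact_Int_closed inf.absorb2)
  ultimately show "X \<in> hyperspace n" by (simp add: hyperspace_def)
qed

section \<open>Hyperfiniteness\<close>

definition finite_borel_equiv :: "'a measure \<Rightarrow> ('a \<times> 'a) set \<Rightarrow> bool" where
  "finite_borel_equiv M F \<longleftrightarrow>
     equiv (space M) F \<and> F \<in> sets (M \<Otimes>\<^sub>M M) \<and> (\<forall>x\<in>space M. finite (F `` {x}))"

text \<open>Only the \<open>\<sigma>\<close>-algebra of \<open>M\<close> matters: \<open>M\<close> plays the role of a standard Borel space.\<close>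

definition hyperfinite :: "'a measure \<Rightarrow> ('a \<times> 'a) set \<Rightarrow> bool" where
  "hyperfinite M E \<longleftrightarrow>
     (\<exists>F :: nat \<Rightarrow> ('a \<times> 'a) set.
        (\<forall>i. finite_borel_equiv M (F i)) \<and> (\<forall>i. F i \<subseteq> F (Suc i)) \<and> E = (\<Union>i. F i))"

definition toeplitz_separated_borel :: "nat \<Rightarrow> (int \<Rightarrow> nat) set measure" where
  "toeplitz_separated_borel n = restrict_space (hyperspace_borel n) (toeplitz_separated n)"

lemma space_toeplitz_separated_borel: "space (toeplitz_separated_borel n) = toeplitz_separated n"
proof -
  interpret Metric_space "hyperspace n" hausdorff_distance by (rule Metric_space_hyperspace)
  have "U \<subseteq> hyperspace n" if "openin (hyperspace_topology n) U" for U
    using openin_subset[OF that] by (simp add: hyperspace_topology_def)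
  then have "space (hyperspace_borel n) = hyperspace n"
    by (auto simp: hyperspace_borel_def intro!: space_measure_of)
  then show ?thesis
    using toeplitz_separated_subset_hyperspace
    by (auto simp: toeplitz_separated_borel_def space_restrict_space)
qed

end

theory Submission
  imports Defs
begin

text \<open>
  Cut a sequence \<open>x\<close> into blocks \<open>x[pk, pk + p)\<close> and let \<open>K\<^sub>p(x)\<close> record which of these blocks
  coincide; equivalently, \<open>K\<^sub>p\<close> is a complete invariant for the action of the finite group of
  permutations of the \<open>p\<close>-blocks. If \<open>X\<close> and \<open>Y\<close> are conjugate by block codes of radius \<open>r\<close>, and \<open>p\<close>
  is such that distinct \<open>p\<close>-holes of points of \<open>X\<close> are more than \<open>4r\<close> apart, then every \<open>x \<in> X\<close> is
  free of \<open>p\<close>-holes immediately to the left or immediately to the right of the cuts \<open>pk\<close>. Applying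
  the code to \<open>x\<close> translated by \<open>-r\<close> or \<open>r\<close> then gives a \<open>y \<in> Y\<close> with \<open>K\<^sub>p(y) = K\<^sub>p(x)\<close>, because
  everything that a block of \<open>y\<close> sees outside the corresponding block of \<open>x\<close> is \<open>p\<close>-periodic, and
  conversely. So conjugate \<open>X\<close> and \<open>Y\<close> satisfy \<open>K\<^sub>p[X] = K\<^sub>p[Y]\<close> for \<open>p = j!\<close> and all large \<open>j\<close>, and the
  relations "\<open>X\<close> and \<open>Y\<close> are conjugate and \<open>K\<^sub>p[X] = K\<^sub>p[Y]\<close> for all \<open>p = j!\<close> with \<open>j \<ge> i\<close>" increase
  to conjugacy with \<open>i\<close>. Their classes are finite since \<open>Y\<close> is the orbit closure of any of its
  points and only finitely many \<open>y\<close> have a given \<open>K\<^sub>p(y)\<close>.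
\<close>

section \<open>Properties that depend on finitely many coordinates\<close>

text \<open>The radius is uniform in the point, so negations stay finitary and such sets are open
  and closed. Openness makes the subshifts that meet one a Borel set; closedness feeds the
  compactness argument in \<open>same_patterns_realize\<close>.\<close>

definition finitary :: "((int \<Rightarrow> nat) \<Rightarrow> bool) \<Rightarrow> bool" where
  "finitary P \<longleftrightarrow> (\<exists>k. \<forall>x y. (\<forall>i. \<bar>i\<bar> < int k \<longrightarrow> x i = y i) \<longrightarrow> P x = P y)"

lemma finite_int_bound: "finite I \<Longrightarrow> \<exists>k. \<forall>i\<in>I. \<bar>i\<bar> < int k"
proof (induction rule: finite_induct)
  case (insert i I)
  then obtain k where "\<forall>i\<in>I. \<bar>i\<bar> < int k" by blast
  then show ?case by (intro exI[of _ "max k (nat \<bar>i\<bar> + 1)"]) fastforce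
qed simp

lemma finitaryI:
  assumes "finite I" "\<And>x y. (\<forall>i\<in>I. x i = y i) \<Longrightarrow> P x = P y"
  shows "finitary P"
proof -
  obtain k where "\<forall>i\<in>I. \<bar>i\<bar> < int k" using finite_int_bound[OF assms(1)] by blast
  then have *: "P x = P y" if "\<forall>i. \<bar>i\<bar> < int k \<longrightarrow> x i = y i" for x y
    using assms(2)[of x y] that by simp
  show ?thesis unfolding finitary_def by (intro exI[of _ k] allI impI) (rule *)
qed

lemma finitary_not: "finitary P \<Longrightarrow> finitary (\<lambda>x. \<not> P x)"
  by (simp add: finitary_def)

text \<open>Agreement with \<open>x\<close> on \<open>|i| < k\<close> defines the closed
  \<open>seq_dist\<close>-ball of radius \<open>(1/2)^k\<close>, and \<open>seq_dist\<close>
  metrizes the product topology.\<close>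

lemma open_seq_iff:
  "open U \<longleftrightarrow> (\<forall>x\<in>U. \<exists>k. \<forall>y. (\<forall>i. \<bar>i\<bar> < int k \<longrightarrow> x i = y i) \<longrightarrow> y \<in> U)"
  for U :: "(int \<Rightarrow> nat) set"
proof -
  interpret M: Metric_space UNIV seq_dist by (rule Metric_space_seq_dist)
  have "open U \<longleftrightarrow> (\<forall>x\<in>U. \<exists>r>0. M.mball x r \<subseteq> U)"
    using M.openin_mtopology[of U] by (auto simp: mtopology_seq_dist)
  also have "\<dots> \<longleftrightarrow> (\<forall>x\<in>U. \<exists>k. \<forall>y. seq_dist x y \<le> (1/2) ^ k \<longrightarrow> y \<in> U)"
  proof (intro ball_cong refl iffI)
    fix x assume "\<exists>r>0. M.mball x r \<subseteq> U"
    then obtain r where r: "r > 0" "M.mball x r \<subseteq> U" by blast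
    obtain k where "(1/2::real) ^ k < r" using real_arch_pow_inv[OF r(1), of "1/2"] by auto
    then show "\<exists>k. \<forall>y. seq_dist x y \<le> (1/2) ^ k \<longrightarrow> y \<in> U"
      using r(2) by (intro exI[of _ k]) (auto simp: subset_eq)
  next
    fix x assume "\<exists>k. \<forall>y. seq_dist x y \<le> (1/2) ^ k \<longrightarrow> y \<in> U"
    then obtain k where "\<forall>y. seq_dist x y \<le> (1/2) ^ k \<longrightarrow> y \<in> U" by blast
    then show "\<exists>r>0. M.mball x r \<subseteq> U" by (intro exI[of _ "(1/2) ^ k"]) auto
  qed
  finally show ?thesis by (simp add: seq_dist_le_iff)
qed

lemma open_finitary:
  assumes "finitary P"
  shows "open {x. P x}"
proof -
  obtain k where "\<And>x y. (\<forall>i. \<bar>i\<bar> < int k \<longrightarrow> x i = y i) \<Longrightarrow> P x = P y"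
    using assms unfolding finitary_def by blast
  then show ?thesis unfolding open_seq_iff mem_Collect_eq by blast
qed

lemma closed_finitary: "finitary P \<Longrightarrow> closed {x. P x}"
  using open_finitary[OF finitary_not] by (simp add: closed_def Collect_neg_eq)

lemma closure_seq_iff:
  "x \<in> closure S \<longleftrightarrow> (\<forall>I. finite I \<longrightarrow> (\<exists>s\<in>S. \<forall>i\<in>I. s i = x i))"
  for x :: "int \<Rightarrow> nat"
proof
  assume x: "x \<in> closure S"
  show "\<forall>I. finite I \<longrightarrow> (\<exists>s\<in>S. \<forall>i\<in>I. s i = x i)"
  proof (intro allI impI)
    fix I :: "int set" assume "finite I"
    then have "open {s. \<forall>i\<in>I. s i = x i}"
      by (intro open_finitary finitaryI[of I]) auto
    with x show "\<exists>s\<in>S. \<forall>i\<in>I. s i = x i"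
      unfolding closure_iff_nhds_not_empty by blast
  qed
next
  assume *: "\<forall>I. finite I \<longrightarrow> (\<exists>s\<in>S. \<forall>i\<in>I. s i = x i)"
  show "x \<in> closure S"
    unfolding closure_iff_nhds_not_empty
  proof (intro allI impI)
    fix A V assume AV: "V \<subseteq> A" "open V" "x \<in> V"
    then obtain k where k: "\<And>y. (\<forall>i. \<bar>i\<bar> < int k \<longrightarrow> x i = y i) \<Longrightarrow> y \<in> V"
      unfolding open_seq_iff by blast
    from *[rule_format, of "{- int k..int k}"]
    obtain s where "s \<in> S" "\<forall>i\<in>{- int k..int k}. s i = x i" by blast
    moreover from this(2) have "s \<in> V" by (intro k) (simp add: abs_less_iff)
    ultimately show "S \<inter> A \<noteq> {}" using AV(1) by blast
  qed
qed

text \<open>If \<open>Y\<close> is closer than \<open>(1/2)^k\<close> to \<open>X\<close>, a witness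
  in \<open>X\<close> has a point of \<open>Y\<close> within \<open>(1/2)^k\<close>, which agrees
  with it on the window that decides \<open>P\<close>.\<close>

lemma openin_hit:
  assumes "finitary P"
  shows "openin (hyperspace_topology n) {X \<in> hyperspace n. \<exists>x\<in>X. P x}"
proof -
  interpret H: Metric_space "hyperspace n" hausdorff_distance by (rule Metric_space_hyperspace)
  obtain k where k: "\<And>x y. (\<forall>i. \<bar>i\<bar> < int k \<longrightarrow> x i = y i) \<Longrightarrow> P x = P y"
    using assms unfolding finitary_def by blast
  have "\<exists>y\<in>Y. P y"
    if "X \<in> hyperspace n" "x \<in> X" "P x" "Y \<in> hyperspace n" "hausdorff_distance X Y < (1/2) ^ k"
    for X Y x
  proof -
    have "Y \<noteq> {}" using that by (auto simp: hyperspace_def)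
    with that INF_le_hausdorff_distance[of x X Y]
    have "(INF y\<in>Y. seq_dist x y) < (1/2) ^ k" by auto
    from cInf_lessD[OF _ this] \<open>Y \<noteq> {}\<close> obtain y where "y \<in> Y" "seq_dist x y < (1/2) ^ k" by auto
    then show ?thesis using k[of x y] \<open>P x\<close> seq_dist_le_iff[of x y k] by auto
  qed
  then show ?thesis
    unfolding hyperspace_topology_def H.openin_mtopology
    by (auto intro!: exI[of _ "(1/2) ^ k"])
qed

text \<open>The source of all measurability below: each relation between subshifts is rewritten as a
  countable Boolean combination of such hits.\<close>

lemma pred_hit:
  assumes "finitary P"
  shows "Measurable.pred (toeplitz_separated_borel n) (\<lambda>X. \<exists>x\<in>X. P x)"
proof -
  interpret H: Metric_space "hyperspace n" hausdorff_distance by (rule Metric_space_hyperspace)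
  have sub: "{U. openin (hyperspace_topology n) U} \<subseteq> Pow (hyperspace n)"
    using openin_subset by (force simp: hyperspace_topology_def)
  have "{X \<in> space (hyperspace_borel n). \<exists>x\<in>X. P x} \<in> sets (hyperspace_borel n)"
    using openin_hit[OF assms, of n] sub
    by (auto simp: hyperspace_borel_def space_measure_of sets_measure_of)
  then show ?thesis
    unfolding toeplitz_separated_borel_def
    by (intro measurable_restrict_space1) (simp add: pred_def)
qed

section \<open>Toeplitz subshifts\<close>

definition translate :: "int \<Rightarrow> (int \<Rightarrow> nat) \<Rightarrow> int \<Rightarrow> nat" where
  "translate k x = (\<lambda>i. x (i + k))"

lemma translate_add: "translate k (translate l x) = translate (k + l) x"
  by (simp add: translate_def algebra_simps)

lemma shift_orbit_eq: "shift_orbit x = range (\<lambda>k. translate k x)"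
  by (simp add: shift_orbit_def translate_def)

lemma shift_eq_translate: "shift = translate 1"
  by (simp add: shift_def translate_def fun_eq_iff)

lemma closure_shift_orbit_iff:
  "y \<in> closure (shift_orbit x) \<longleftrightarrow> (\<forall>I. finite I \<longrightarrow> (\<exists>k. \<forall>i\<in>I. x (i + k) = y i))"
  by (auto simp: closure_seq_iff shift_orbit_def)

lemma translate_closure_shift_orbit:
  assumes "y \<in> closure (shift_orbit x)"
  shows "translate c y \<in> closure (shift_orbit x)"
  unfolding closure_shift_orbit_iff
proof (intro allI impI)
  fix I :: "int set" assume "finite I"
  with assms obtain k where "\<forall>i\<in>(\<lambda>i. i + c) ` I. x (i + k) = y i"
    unfolding closure_shift_orbit_iff by blast
  then show "\<exists>k. \<forall>i\<in>I. x (i + k) = translate c y i"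
    by (intro exI[of _ "c + k"]) (auto simp: translate_def algebra_simps)
qed

lemma Per_dvd_mono:
  assumes "p dvd q"
  shows "Per p x \<subseteq> Per q x"
proof -
  obtain c where "q = p * c" using assms by (rule dvdE)
  then have *: "int q * k = int p * (int c * k)" for k by (simp add: mult.assoc)
  show ?thesis by (auto simp: Per_def *)
qed

lemma toeplitz_common_period:
  assumes "toeplitz_sequence n \<alpha>" "finite I"
  shows "\<exists>q>0. I \<subseteq> Per q \<alpha>"
  using assms(2)
proof (induction rule: finite_induct)
  case (insert i I)
  then obtain q where q: "q > 0" "I \<subseteq> Per q \<alpha>" by blast
  obtain p where p: "p > 0" "i \<in> Per p \<alpha>"
    using assms(1) unfolding toeplitz_sequence_def by blast
  show ?case
    using p q Per_dvd_mono[of p "p * q" \<alpha>] Per_dvd_mono[of q "p * q" \<alpha>]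
    by (intro exI[of _ "p * q"]) auto
qed auto

text \<open>A finite pattern of \<open>z\<close> occurs in \<alpha> on coordinates with a common
  period \<open>q\<close>, hence recurs with period \<open>q\<close>, and every long enough stretch
  of \<open>y\<close> shows it. So a Toeplitz subshift is recovered from any one of its
  points.\<close>

lemma toeplitz_subshift_minimal:
  assumes X: "toeplitz_subshift n X" and y: "y \<in> X"
  shows "X = closure (shift_orbit y)"
proof -
  obtain \<alpha> where \<alpha>: "toeplitz_sequence n \<alpha>" and X_eq: "X = closure (shift_orbit \<alpha>)"
    using X unfolding toeplitz_subshift_def by blast
  have "shift_orbit y \<subseteq> X"
    using y translate_closure_shift_orbit by (auto simp: shift_orbit_eq X_eq)
  then have "closure (shift_orbit y) \<subseteq> X"
    by (simp add: X_eq closure_minimal)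
  moreover have "z \<in> closure (shift_orbit y)" if z: "z \<in> X" for z
    unfolding closure_shift_orbit_iff
  proof (intro allI impI)
    fix I :: "int set" assume I: "finite I"
    obtain a where a: "\<And>i. i \<in> I \<Longrightarrow> \<alpha> (i + a) = z i"
      using z I unfolding X_eq closure_shift_orbit_iff by blast
    obtain q where q: "q > 0" "(\<lambda>i. i + a) ` I \<subseteq> Per q \<alpha>"
      using toeplitz_common_period[OF \<alpha> finite_imageI[OF I]] by blast
    \<comment> \<open>The window is widened by all \<open>t\<close> below \<open>q\<close>, so that
      some \<open>b + t\<close> is congruent to \<open>a\<close> modulo \<open>q\<close>.\<close>
    have "finite (\<Union>i\<in>I. (\<lambda>t. i + t) ` {0..<int q})" using I by blast
    then obtain b where b: "\<And>i t. \<lbrakk>i \<in> I; 0 \<le> t; t < int q\<rbrakk> \<Longrightarrow> \<alpha> (i + t + b) = y (i + t)"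
      using y unfolding X_eq closure_shift_orbit_iff by fastforce
    define t where "t = (a - b) mod int q"
    have t: "0 \<le> t" "t < int q" using q(1) by (auto simp: t_def)
    have t_eq: "t + b = a + int q * (- ((a - b) div int q))"
      by (simp add: t_def minus_mult_div_eq_mod[symmetric])
    have "y (i + t) = z i" if "i \<in> I" for i
    proof -
      have "y (i + t) = \<alpha> (i + a + int q * (- ((a - b) div int q)))"
        using b[OF that t] t_eq by (metis add.assoc)
      also have "\<dots> = \<alpha> (i + a)" using q(2) that unfolding Per_def by blast
      finally show ?thesis using a[OF that] by simp
    qed
    then show "\<exists>k. \<forall>i\<in>I. y (i + k) = z i" by blast
  qed
  ultimately show ?thesis by blast
qed

lemma toeplitz_subshift_translate:
  "\<lbrakk>toeplitz_subshift n X; x \<in> X\<rbrakk> \<Longrightarrow> translate k x \<in> X"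
  using translate_closure_shift_orbit unfolding toeplitz_subshift_def by blast

text \<open>\<open>separated_holes\<close> speaks of one point. The bound passes to every
  \<open>x\<close> in \<open>X\<close> because a hole is witnessed by two unequal coordinates, and
  the four coordinates behind two holes of \<open>x\<close> occur in a translate of
  \<alpha>.\<close>

lemma separated_holes_far:
  assumes X: "toeplitz_subshift n X" "separated_holes X"
  shows "\<exists>u>0. \<forall>x\<in>X. \<forall>i\<in>holes u x. \<forall>j\<in>holes u x. i \<noteq> j \<longrightarrow> int d < \<bar>i - j\<bar>"
proof -
  obtain u \<alpha> where u: "\<And>i. 0 < u i" and \<alpha>: "\<alpha> \<in> X"
      and lim: "(\<lambda>i. hole_gap (u i) \<alpha>) \<longlonglongrightarrow> \<infinity>"
    using X(2) unfolding separated_holes_def factorization_def by blast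
  have "\<forall>\<^sub>F i in sequentially. enat d < hole_gap (u i) \<alpha>"
    using order_tendstoD(1)[OF lim, of "enat d"] by simp
  then obtain m where m: "enat d < hole_gap (u m) \<alpha>"
    by (meson eventually_sequentially order_refl)
  have gap: "int d < \<bar>i - j\<bar>"
    if "i \<in> holes (u m) \<alpha>" "j \<in> holes (u m) \<alpha>" "i \<noteq> j" for i j
  proof -
    have "hole_gap (u m) \<alpha> \<le> enat (nat \<bar>i - j\<bar>)"
      unfolding hole_gap_def by (rule Inf_lower) (use that in blast)
    with m have "enat d < enat (nat \<bar>i - j\<bar>)" by (rule less_le_trans)
    then show ?thesis by simp
  qed
  have "int d < \<bar>i - j\<bar>"
    if x: "x \<in> X" and ij: "i \<in> holes (u m) x" "j \<in> holes (u m) x" "i \<noteq> j" for x i j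
  proof -
    obtain k l where kl: "x (i + int (u m) * k) \<noteq> x i" "x (j + int (u m) * l) \<noteq> x j"
      using ij unfolding holes_def Per_def by blast
    have "finite {i, j, i + int (u m) * k, j + int (u m) * l}" by simp
    then obtain b where b: "\<forall>s\<in>{i, j, i + int (u m) * k, j + int (u m) * l}. \<alpha> (s + b) = x s"
      using x toeplitz_subshift_minimal[OF X(1) \<alpha>] closure_shift_orbit_iff by metis
    then have "\<alpha> (i + b + int (u m) * k) \<noteq> \<alpha> (i + b)" "\<alpha> (j + b + int (u m) * l) \<noteq> \<alpha> (j + b)"
      using kl by (simp_all add: ac_simps)
    then have "i + b \<in> holes (u m) \<alpha>" "j + b \<in> holes (u m) \<alpha>"
      unfolding holes_def Per_def by blast+
    from gap[OF this] ij(3) show ?thesis by simp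
  qed
  then show ?thesis using u[of m] by blast
qed

section \<open>Block codes\<close>

definition window :: "nat \<Rightarrow> (int \<Rightarrow> nat) \<Rightarrow> int \<Rightarrow> int \<Rightarrow> nat" where
  "window r x i = (\<lambda>j\<in>{- int r..int r}. x (i + j))"

definition words :: "nat \<Rightarrow> nat \<Rightarrow> (int \<Rightarrow> nat) set" where
  "words n r = (\<Pi>\<^sub>E j\<in>{- int r..int r}. {..<n})"

text \<open>Codes are extensional on the finite set \<open>words n r\<close>, so each radius has
  finitely many of them and quantifying over codes preserves measurability.\<close>

definition codes :: "nat \<Rightarrow> nat \<Rightarrow> ((int \<Rightarrow> nat) \<Rightarrow> nat) set" where
  "codes n r = (\<Pi>\<^sub>E w\<in>words n r. {..<n})"

definition apply_code :: "nat \<Rightarrow> ((int \<Rightarrow> nat) \<Rightarrow> nat) \<Rightarrow> (int \<Rightarrow> nat) \<Rightarrow> int \<Rightarrow> nat" where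
  "apply_code r f x = (\<lambda>i. f (window r x i))"

lemma finite_words: "finite (words n r)"
  by (simp add: words_def finite_PiE)

lemma finite_codes: "finite (codes n r)"
  by (simp add: codes_def finite_words finite_PiE)

lemma window_in_words: "x \<in> full_shift n \<Longrightarrow> window r x i \<in> words n r"
  by (auto simp: window_def words_def full_shift_def)

lemma window_eq_iff: "window r x i = window r y k \<longleftrightarrow> (\<forall>j. \<bar>j\<bar> \<le> int r \<longrightarrow> x (i + j) = y (k + j))"
  unfolding window_def restrict_def fun_eq_iff by (auto simp: abs_le_iff)

lemma window_translate: "window r (translate k x) i = window r x (i + k)"
  by (simp add: window_def translate_def algebra_simps restrict_def)

lemma apply_code_translate: "apply_code r f (translate k x) = translate k (apply_code r f x)"
  by (simp add: apply_code_def window_translate) (simp add: translate_def)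

lemma apply_code_in_full_shift:
  "\<lbrakk>f \<in> codes n r; x \<in> full_shift n\<rbrakk> \<Longrightarrow> apply_code r f x \<in> full_shift n"
  using window_in_words by (fastforce simp: apply_code_def codes_def full_shift_def PiE_iff)

lemma apply_code_cong:
  "(\<And>j. \<bar>j\<bar> \<le> int r \<Longrightarrow> x (i + j) = y (k + j)) \<Longrightarrow> apply_code r f x i = apply_code r f y k"
  unfolding apply_code_def using window_eq_iff by metis

lemma apply_code_local:
  "(\<And>j. \<bar>j\<bar> \<le> \<bar>i\<bar> + int r \<Longrightarrow> x j = y j) \<Longrightarrow> apply_code r f x i = apply_code r f y i"
  by (rule apply_code_cong) (smt (verit))

lemma finitary_apply_code: "finitary (\<lambda>x. apply_code r f x i = v)"
proof (rule finitaryI)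
  fix x y :: "int \<Rightarrow> nat" assume "\<forall>j\<in>{- (\<bar>i\<bar> + int r)..\<bar>i\<bar> + int r}. x j = y j"
  then have "apply_code r f x i = apply_code r f y i"
    by (intro apply_code_local) (simp add: abs_le_iff)
  then show "(apply_code r f x i = v) = (apply_code r f y i = v)" by simp
qed simp

section \<open>Continuous equivariant maps and block codes (Curtis-Hedlund-Lyndon)\<close>

lemma continuous_on_apply_code: "continuous_on S (apply_code r f)"
proof (rule continuous_on_coordinatewise_then_product)
  fix i
  have "open ((\<lambda>x. apply_code r f x i) -` B)" for B
  proof -
    have "(\<lambda>x. apply_code r f x i) -` B = (\<Union>v\<in>B. {x. apply_code r f x i = v})" by auto
    then show ?thesis by (auto intro!: open_finitary finitary_apply_code)
  qed
  then have "continuous_on UNIV (\<lambda>x. apply_code r f x i)"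
    by (simp add: continuous_on_open_vimage[OF open_UNIV])
  then show "continuous_on S (\<lambda>x. apply_code r f x i)"
    by (rule continuous_on_subset) simp
qed

text \<open>Continuity gives each point a cylinder on which coordinate 0 of the image is constant;
  compactness leaves finitely many cylinders and hence one radius. The other coordinates follow by
  equivariance in \<open>code_of_conjugacy\<close>.\<close>

lemma curtis_hedlund:
  fixes \<pi> :: "(int \<Rightarrow> nat) \<Rightarrow> int \<Rightarrow> nat"
  assumes X: "compact X" and cont: "continuous_on X \<pi>"
  shows "\<exists>r. \<forall>x\<in>X. \<forall>y\<in>X. (\<forall>j. \<bar>j\<bar> \<le> int r \<longrightarrow> x j = y j) \<longrightarrow> \<pi> x 0 = \<pi> y 0"
proof -
  have "\<exists>k. \<forall>y\<in>X. (\<forall>i. \<bar>i\<bar> < int k \<longrightarrow> x i = y i) \<longrightarrow> \<pi> x 0 = \<pi> y 0" if x: "x \<in> X" for x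
  proof -
    have "finitary (\<lambda>z. z 0 = \<pi> x 0)"
      by (rule finitaryI[of "{0}"]) auto
    then have "open {z :: int \<Rightarrow> nat. z 0 = \<pi> x 0}" by (rule open_finitary)
    then obtain A where A: "open A" "A \<inter> X = \<pi> -` {z :: int \<Rightarrow> nat. z 0 = \<pi> x 0} \<inter> X"
      using cont continuous_on_open_invariant by metis
    then have "x \<in> A" using x by blast
    then obtain k where "\<And>y. (\<forall>i. \<bar>i\<bar> < int k \<longrightarrow> x i = y i) \<Longrightarrow> y \<in> A"
      using A(1) unfolding open_seq_iff by blast
    then have "\<pi> x 0 = \<pi> y 0" if "y \<in> X" "\<forall>i. \<bar>i\<bar> < int k \<longrightarrow> x i = y i" for y
    proof -
      have "y \<in> A \<inter> X" using that \<open>\<And>y. (\<forall>i. \<bar>i\<bar> < int k \<longrightarrow> x i = y i) \<Longrightarrow> y \<in> A\<close>[of y] by simp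
      then show ?thesis using A(2) by auto
    qed
    then show ?thesis by blast
  qed
  then obtain k where k: "\<And>x y. \<lbrakk>x \<in> X; y \<in> X; \<forall>i. \<bar>i\<bar> < int (k x) \<longrightarrow> x i = y i\<rbrakk> \<Longrightarrow> \<pi> x 0 = \<pi> y 0"
    by metis
  define C where "C x = {y. \<forall>i. \<bar>i\<bar> < int (k x) \<longrightarrow> x i = y i}" for x
  have "open (C x)" for x
    unfolding C_def
    by (intro open_finitary finitaryI[of "{- int (k x)..int (k x)}"]) (auto simp: abs_less_iff)
  moreover have "X \<subseteq> (\<Union>x\<in>X. C x)" by (auto simp: C_def)
  ultimately obtain S where S: "S \<subseteq> X" "finite S" "X \<subseteq> (\<Union>x\<in>S. C x)"
    using compactE_image[OF X, of X C] by metis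
  define r where "r = Max (insert 0 (k ` S))"
  have r: "k s \<le> r" if "s \<in> S" for s using that S(2) by (simp add: r_def)
  show ?thesis
  proof (intro exI[of _ r] ballI impI)
    fix x y assume xy: "x \<in> X" "y \<in> X" "\<forall>j. \<bar>j\<bar> \<le> int r \<longrightarrow> x j = y j"
    then obtain s where s: "s \<in> S" "x \<in> C s" using S(3) by blast
    then have "y \<in> C s" using xy(3) r[OF s(1)] by (force simp: C_def)
    with s have "\<pi> s 0 = \<pi> x 0" "\<pi> s 0 = \<pi> y 0"
      using k[of s] S(1) xy by (auto simp: C_def)
    then show "\<pi> x 0 = \<pi> y 0" by simp
  qed
qed

text \<open>Block codes are automatically continuous and commute with the shift, so a mutually
  inverse pair expresses conjugacy. The common radius and the explicit inverse make this
  symmetric.\<close>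

definition conjugating_codes ::
  "nat \<Rightarrow> ((int \<Rightarrow> nat) \<Rightarrow> nat) \<Rightarrow> ((int \<Rightarrow> nat) \<Rightarrow> nat) \<Rightarrow> (int \<Rightarrow> nat) set \<Rightarrow> (int \<Rightarrow> nat) set \<Rightarrow> bool"
where
  "conjugating_codes r f g X Y \<longleftrightarrow>
     apply_code r f ` X \<subseteq> Y \<and> apply_code r g ` Y \<subseteq> X \<and>
     (\<forall>x\<in>X. apply_code r g (apply_code r f x) = x) \<and>
     (\<forall>y\<in>Y. apply_code r f (apply_code r g y) = y)"

lemma toeplitz_separatedD:
  assumes "X \<in> toeplitz_separated n"
  shows "toeplitz_subshift n X" "separated_holes X" "X \<subseteq> full_shift n" "X \<noteq> {}"
    "compact X" "closed X" "\<And>x k. x \<in> X \<Longrightarrow> translate k x \<in> X"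
  using assms toeplitz_separated_subset_hyperspace[of n] toeplitz_subshift_translate[of n X]
    compact_seq_imp_closed
  by (auto simp: toeplitz_separated_def hyperspace_def)

lemma code_of_conjugacy:
  assumes X: "\<And>x k. x \<in> X \<Longrightarrow> translate k x \<in> X" "X \<subseteq> full_shift n"
    and Y: "\<pi> ` X \<subseteq> full_shift n"
    and comm: "\<And>x. x \<in> X \<Longrightarrow> \<pi> (shift x) = shift (\<pi> x)"
    and r: "\<And>x y. \<lbrakk>x \<in> X; y \<in> X; \<forall>j. \<bar>j\<bar> \<le> int r \<longrightarrow> x j = y j\<rbrakk> \<Longrightarrow> \<pi> x 0 = \<pi> y 0"
    and n: "n > 0"
  shows "\<exists>f\<in>codes n r. \<forall>x\<in>X. apply_code r f x = \<pi> x"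
proof -
  have nat_comm: "\<pi> (translate (int k) x) = translate (int k) (\<pi> x)" if "x \<in> X" for k x
  proof (induction k)
    case (Suc k)
    have "\<pi> (translate (int (Suc k)) x) = \<pi> (shift (translate (int k) x))"
      by (simp add: shift_eq_translate translate_add add.commute)
    also have "\<dots> = shift (translate (int k) (\<pi> x))"
      using comm[OF X(1)[OF that]] Suc by simp
    finally show ?case by (simp add: shift_eq_translate translate_add add.commute)
  qed (simp add: translate_def)
  \<comment> \<open>For negative \<open>k\<close>, translate the image forward by
    \<open>- k\<close>, use the case already proved, and translate back.\<close>
  have comm': "\<pi> (translate k x) = translate k (\<pi> x)" if x: "x \<in> X" for k x
  proof (cases "k \<ge> 0")
    case True
    then show ?thesis using nat_comm[OF x, of "nat k"] by simp
  next
    case False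
    have "translate (- k) (\<pi> (translate k x)) = \<pi> (translate (- k) (translate k x))"
      using nat_comm[OF X(1)[OF x, of k], of "nat (- k)"] False by simp
    also have "\<dots> = \<pi> x" by (simp add: translate_add) (simp add: translate_def)
    finally have "translate k (\<pi> x) = translate k (translate (- k) (\<pi> (translate k x)))" by simp
    then show ?thesis by (simp add: translate_add) (simp add: translate_def)
  qed
  \<comment> \<open>Words that do not occur in \<open>X\<close> get the default 0, a legal letter
    because \<open>n > 0\<close>. For words that occur, the value is independent of the chosen point
    by \<open>r\<close>.\<close>
  define f where "f = (\<lambda>w\<in>words n r. if \<exists>x\<in>X. window r x 0 = w
      then \<pi> (SOME x. x \<in> X \<and> window r x 0 = w) 0 else 0)"
  have f: "f (window r x 0) = \<pi> x 0" if x: "x \<in> X" for x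
  proof -
    define y where "y = (SOME y. y \<in> X \<and> window r y 0 = window r x 0)"
    have y: "y \<in> X \<and> window r y 0 = window r x 0"
      unfolding y_def by (rule someI[of _ x]) (use x in simp)
    have "window r x 0 \<in> words n r" using window_in_words X(2) x by blast
    then have "f (window r x 0) = \<pi> y 0"
      using x by (auto simp: f_def y_def)
    also have "\<dots> = \<pi> x 0" using r[of y x] y x by (simp add: window_eq_iff)
    finally show ?thesis .
  qed
  have "f \<in> codes n r"
    unfolding codes_def
  proof (rule PiE_I)
    fix w assume w: "w \<in> words n r"
    show "f w \<in> {..<n}"
    proof (cases "\<exists>x\<in>X. window r x 0 = w")
      case True
      then show ?thesis using f Y by (force simp: full_shift_def)
    qed (use w n in \<open>simp add: f_def\<close>)
  qed (simp add: f_def)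
  moreover have "apply_code r f x = \<pi> x" if x: "x \<in> X" for x
  proof
    fix i
    have "apply_code r f x i = f (window r (translate i x) 0)"
      by (simp add: apply_code_def window_translate)
    also have "\<dots> = translate i (\<pi> x) 0" using f[OF X(1)[OF x]] comm'[OF x] by simp
    finally show "apply_code r f x i = \<pi> x i" by (simp add: translate_def)
  qed
  ultimately show ?thesis by blast
qed

text \<open>The choice of a homeomorphism becomes a countable one: a radius and two codes from a
  finite set. Both measurability and symmetry of conjugacy rest on this form.\<close>

lemma topologically_conjugate_iff_codes:
  assumes X: "X \<in> toeplitz_separated n" and Y: "Y \<in> toeplitz_separated n"
  shows "topologically_conjugate X Y \<longleftrightarrow>
    (\<exists>r. \<exists>f\<in>codes n r. \<exists>g\<in>codes n r. conjugating_codes r f g X Y)"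
proof
  note X' = toeplitz_separatedD[OF X] and Y' = toeplitz_separatedD[OF Y]
  assume "topologically_conjugate X Y"
  then obtain \<pi> \<rho> where hom: "homeomorphism X Y \<pi> \<rho>"
      and comm: "\<And>x. x \<in> X \<Longrightarrow> \<pi> (shift x) = shift (\<pi> x)"
    unfolding topologically_conjugate_def by blast
  have comm': "\<rho> (shift y) = shift (\<rho> y)" if "y \<in> Y" for y
  proof -
    have "\<rho> y \<in> X" "\<pi> (\<rho> y) = y" using that hom by (auto simp: homeomorphism_def)
    then have "\<rho> (shift y) = \<rho> (\<pi> (shift (\<rho> y)))" using comm by simp
    also have "\<dots> = shift (\<rho> y)"
      using X'(7)[OF \<open>\<rho> y \<in> X\<close>, of 1] hom by (simp add: homeomorphism_def shift_eq_translate)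
    finally show ?thesis .
  qed
  have cont: "continuous_on X \<pi>" "continuous_on Y \<rho>"
    using hom by (simp_all add: homeomorphism_def)
  obtain r1 where r1: "\<forall>x\<in>X. \<forall>y\<in>X. (\<forall>j. \<bar>j\<bar> \<le> int r1 \<longrightarrow> x j = y j) \<longrightarrow> \<pi> x 0 = \<pi> y 0"
    using curtis_hedlund[OF X'(5) cont(1)] ..
  obtain r2 where r2: "\<forall>x\<in>Y. \<forall>y\<in>Y. (\<forall>j. \<bar>j\<bar> \<le> int r2 \<longrightarrow> x j = y j) \<longrightarrow> \<rho> x 0 = \<rho> y 0"
    using curtis_hedlund[OF Y'(5) cont(2)] ..
  define r where "r = max r1 r2"
  have n: "n > 0" using X'(3,4) by (auto simp: full_shift_def)
  have "\<exists>f\<in>codes n r. \<forall>x\<in>X. apply_code r f x = \<pi> x"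
  proof (rule code_of_conjugacy)
    show "\<pi> ` X \<subseteq> full_shift n" using hom Y'(3) by (simp add: homeomorphism_def)
    show "\<pi> x 0 = \<pi> y 0" if "x \<in> X" "y \<in> X" "\<forall>j. \<bar>j\<bar> \<le> int r \<longrightarrow> x j = y j" for x y
      using r1[rule_format, of x y] that by (simp add: r_def)
  qed (fact X'(7) X'(3) comm n)+
  then obtain f where f: "f \<in> codes n r" "\<forall>x\<in>X. apply_code r f x = \<pi> x" ..
  have "\<exists>g\<in>codes n r. \<forall>y\<in>Y. apply_code r g y = \<rho> y"
  proof (rule code_of_conjugacy)
    show "\<rho> ` Y \<subseteq> full_shift n" using hom X'(3) by (simp add: homeomorphism_def)
    show "\<rho> x 0 = \<rho> y 0" if "x \<in> Y" "y \<in> Y" "\<forall>j. \<bar>j\<bar> \<le> int r \<longrightarrow> x j = y j" for x y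
      using r2[rule_format, of x y] that by (simp add: r_def)
  qed (fact Y'(7) Y'(3) comm' n)+
  then obtain g where g: "g \<in> codes n r" "\<forall>y\<in>Y. apply_code r g y = \<rho> y" ..
  have "conjugating_codes r f g X Y"
    using f(2) g(2) hom unfolding conjugating_codes_def homeomorphism_def by auto
  with f(1) g(1) show "\<exists>r. \<exists>f\<in>codes n r. \<exists>g\<in>codes n r. conjugating_codes r f g X Y" by blast
next
  assume "\<exists>r. \<exists>f\<in>codes n r. \<exists>g\<in>codes n r. conjugating_codes r f g X Y"
  then obtain r f g where c: "conjugating_codes r f g X Y" by blast
  have "homeomorphism X Y (apply_code r f) (apply_code r g)"
    using c by (intro homeomorphismI continuous_on_apply_code) (auto simp: conjugating_codes_def)
  then show "topologically_conjugate X Y"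
    unfolding topologically_conjugate_def shift_eq_translate using apply_code_translate by blast
qed

text \<open>A closed set contains every sequence whose central windows it all realizes. Inclusion
  thus becomes countably many implications between hits.\<close>

lemma subset_closed_iff_windows:
  assumes "closed Y" "\<And>y k. y \<in> Y \<Longrightarrow> translate k y \<in> Y"
    and "Z \<subseteq> full_shift n"
  shows "Z \<subseteq> Y \<longleftrightarrow>
    (\<forall>m. \<forall>w\<in>words n m. (\<exists>z\<in>Z. window m z 0 = w) \<longrightarrow> (\<exists>y\<in>Y. window m y 0 = w))"
proof (intro iffI subsetI)
  fix z assume *: "\<forall>m. \<forall>w\<in>words n m. (\<exists>z\<in>Z. window m z 0 = w) \<longrightarrow> (\<exists>y\<in>Y. window m y 0 = w)"
    and z: "z \<in> Z"
  have "z \<in> closure Y"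
    unfolding closure_seq_iff
  proof (intro allI impI)
    fix I :: "int set" assume "finite I"
    then obtain m where m: "\<forall>i\<in>I. \<bar>i\<bar> < int m" using finite_int_bound by blast
    obtain y where "y \<in> Y" "window m y 0 = window m z 0"
      using *[rule_format, OF window_in_words, of z m 0] z assms(3) by blast
    then show "\<exists>y\<in>Y. \<forall>i\<in>I. y i = z i"
      using m by (intro bexI[of _ y]) (auto simp: window_eq_iff)
  qed
  then show "z \<in> Y" using assms(1) by simp
qed blast

section \<open>Block patterns\<close>

text \<open>The \<open>K\<^sub>p\<close> of the overview, as an equivalence relation on block
  indices that forgets the contents of the blocks.\<close>

definition block_pattern :: "nat \<Rightarrow> (int \<Rightarrow> nat) \<Rightarrow> (int \<times> int) set" where
  "block_pattern p x = {(a, b). \<forall>i\<in>{0..<int p}. x (int p * a + i) = x (int p * b + i)}"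

text \<open>A pattern truncated to \<open>square m\<close> has finitely many possible values, and
  attaining a given one is a finitary condition.\<close>

definition square :: "nat \<Rightarrow> (int \<times> int) set" where
  "square m = {- int m..int m} \<times> {- int m..int m}"

lemma finitary_block_pattern: "finitary (\<lambda>x. block_pattern p x \<inter> square m = S)"
proof (rule finitaryI)
  let ?I = "(\<lambda>(a, i). int p * a + i) ` ({- int m..int m} \<times> {0..<int p})"
  show "finite ?I" by simp
  fix x y :: "int \<Rightarrow> nat" assume *: "\<forall>i\<in>?I. x i = y i"
  have "x (int p * a + i) = y (int p * a + i)" if "a \<in> {- int m..int m}" "i \<in> {0..<int p}" for a i
    using * that by (metis (mono_tags, lifting) SigmaI case_prod_conv image_eqI)
  then have "block_pattern p x \<inter> square m = block_pattern p y \<inter> square m"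
    by (auto simp: block_pattern_def square_def)
  then show "(block_pattern p x \<inter> square m = S) = (block_pattern p y \<inter> square m = S)" by simp
qed

section \<open>Finiteness of the set of sequences with a given block pattern\<close>

lemma restrict_eq_iff: "restrict f A = restrict g A \<longleftrightarrow> (\<forall>x\<in>A. f x = g x)"
  by (auto simp: restrict_def fun_eq_iff)

text \<open>A sequence \<open>z\<close> with the pattern of \<open>x\<close> arises from
  \<open>x\<close> by a substitution of blocks, which is well defined because equal blocks of
  \<open>x\<close> go to equal blocks of \<open>z\<close>. There are finitely many substitutions on
  the finite set \<open>B\<close>.\<close>

lemma finite_block_pattern_fibre:
  assumes p: "p > 0" and x: "x \<in> full_shift n"
  shows "finite {z \<in> full_shift n. block_pattern p z = block_pattern p x}"
proof -
  let ?Z = "{z \<in> full_shift n. block_pattern p z = block_pattern p x}"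
  define block where "block z a = (\<lambda>i\<in>{0..<int p}. z (int p * a + i))" for z :: "int \<Rightarrow> nat" and a
  define B where "B = (\<Pi>\<^sub>E i\<in>{0..<int p}. {..<n})"
  have block_eq: "block z a = block z b \<longleftrightarrow> (a, b) \<in> block_pattern p z" for z a b
    by (simp add: block_def block_pattern_def restrict_eq_iff)
  have in_B: "block z a \<in> B" if "z \<in> full_shift n" for z a
    using that by (auto simp: block_def full_shift_def B_def)
  \<comment> \<open>The substitution with values wrapped in sets: for \<open>z\<close> in
    \<open>?Z\<close>, a singleton if \<open>w\<close> is a block of \<open>x\<close>, and empty
    otherwise.\<close>
  define code where "code z = (\<lambda>w\<in>B. {block z a | a. block x a = w})" for z
  have code: "code z (block x a) = {block z a}" if "z \<in> ?Z" for z a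
  proof -
    have "block x b = block x a \<longleftrightarrow> block z b = block z a" for b
      using that by (simp add: block_eq)
    then show ?thesis using in_B[OF x, of a] by (auto simp: code_def)
  qed
  have "inj_on code ?Z"
  proof (intro inj_onI ext)
    fix y z and s :: int assume yz: "y \<in> ?Z" "z \<in> ?Z" "code y = code z"
    define a where "a = s div int p"
    have "block y a = block z a" using code[OF yz(1), of a] code[OF yz(2), of a] yz(3) by simp
    then have "block y a (s mod int p) = block z a (s mod int p)" by simp
    then show "y s = z s" using p by (simp add: block_def a_def)
  qed
  moreover have "code ` ?Z \<subseteq> (\<Pi>\<^sub>E w\<in>B. Pow B)"
    using in_B by (auto simp: code_def)
  moreover have "finite (\<Pi>\<^sub>E w\<in>B. Pow B)" by (simp add: B_def finite_PiE)
  ultimately show ?thesis using finite_imageD finite_subset by blast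
qed

text \<open>\<open>free\<close> covers the coordinates near the cut 0 through which a block of one
  sequence can depend on letters outside the corresponding block of the other. By periodicity these
  look the same at every cut, so equality of blocks passes in both directions.\<close>

lemma block_pattern_apply_code:
  assumes free: "\<And>i. \<lbrakk>min 0 (k - int r) \<le> i; i < max 0 (k + int r)\<rbrakk> \<Longrightarrow> i \<in> Per p x"
    and inv: "apply_code r g (apply_code r f x) = x"
  shows "block_pattern p (translate k (apply_code r f x)) = block_pattern p x"
proof -
  define y where "y = translate k (apply_code r f x)"
  have y: "y i = apply_code r f x (i + k)" for i by (simp add: y_def translate_def)
  have x: "x (i + k) = apply_code r g y i" for i
    using inv unfolding y_def apply_code_translate by (simp add: translate_def)
  have "(\<forall>i\<in>{0..<int p}. y (int p * a + i) = y (int p * b + i)) \<longleftrightarrow>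
        (\<forall>i\<in>{0..<int p}. x (int p * a + i) = x (int p * b + i))" for a b
  proof -
    have per: "x (int p * a + i) = x (int p * b + i)" "x (int p * a + int p + i) = x (int p * b + int p + i)"
      if "min 0 (k - int r) \<le> i" "i < max 0 (k + int r)" for i
    proof -
      have "x (i + int p * c) = x i" for c using free[OF that] by (simp add: Per_def)
      from this[of a] this[of b] this[of "a + 1"] this[of "b + 1"] show
        "x (int p * a + i) = x (int p * b + i)" "x (int p * a + int p + i) = x (int p * b + int p + i)"
        by (simp_all add: algebra_simps)
    qed
    show ?thesis
    proof (intro iffI ballI)
      fix s assume *: "\<forall>i\<in>{0..<int p}. x (int p * a + i) = x (int p * b + i)"
        and s: "s \<in> {0..<int p}"
      \<comment> \<open>Relative to the left cut, this range contains all coordinates of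
        \<open>x\<close> that the code reads for one block of \<open>y\<close>.\<close>
      have wide: "x (int p * a + i) = x (int p * b + i)"
        if "min 0 (k - int r) \<le> i" "i < int p + max 0 (k + int r)" for i
      proof -
        consider "i < 0" | "0 \<le> i" "i < int p" | "int p \<le> i" by linarith
        then show ?thesis
        proof cases
          case 1
          then show ?thesis using that by (intro per) auto
        next
          case 2
          then show ?thesis using * by auto
        next
          case 3
          then show ?thesis using that per(2)[of "i - int p"] by auto
        qed
      qed
      show "y (int p * a + s) = y (int p * b + s)"
        unfolding y
      proof (rule apply_code_cong)
        fix j assume "\<bar>j\<bar> \<le> int r"
        then have "x (int p * a + (s + k + j)) = x (int p * b + (s + k + j))"
          using s by (intro wide) auto
        then show "x (int p * a + s + k + j) = x (int p * b + s + k + j)"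
          by (simp add: add.assoc)
      qed
    next
      fix s assume *: "\<forall>i\<in>{0..<int p}. y (int p * a + i) = y (int p * b + i)"
        and s: "s \<in> {0..<int p}"
      \<comment> \<open>Near either cut \<open>x\<close> is periodic; in the remaining middle the
        inverse code reads only letters inside the block of \<open>y\<close>.\<close>
      consider "s < k + int r" | "s - int p \<ge> k - int r" | "k + int r \<le> s" "s < int p + k - int r"
        by linarith
      then show "x (int p * a + s) = x (int p * b + s)"
      proof cases
        case 1
        then show ?thesis using s by (intro per) auto
      next
        case 2
        then show ?thesis using s per(2)[of "s - int p"] by auto
      next
        case 3
        have "apply_code r g y (int p * a + (s - k)) = apply_code r g y (int p * b + (s - k))"
        proof (rule apply_code_cong)
          fix j assume "\<bar>j\<bar> \<le> int r"
          then have "s - k + j \<in> {0..<int p}" using 3 by auto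
          with * have "y (int p * a + (s - k + j)) = y (int p * b + (s - k + j))" by blast
          then show "y (int p * a + (s - k) + j) = y (int p * b + (s - k) + j)"
            by (simp only: add.assoc)
        qed
        then show ?thesis using x[of "int p * a + (s - k)"] x[of "int p * b + (s - k)"] by simp
      qed
    qed
  qed
  then show ?thesis by (simp add: block_pattern_def y_def)
qed

text \<open>The period \<open>u\<close> given by hole separation divides \<open>fact j\<close> for
  all \<open>j \<ge> u\<close>, and passing to a multiple creates no new holes. The offset
  \<open>k\<close> may vary with the point, since \<open>Y\<close> is translation invariant and only
  sets of patterns are compared.\<close>

lemma conjugate_imp_block_patterns:
  assumes X: "X \<in> toeplitz_separated n" and Y: "Y \<in> toeplitz_separated n"
    and conj: "topologically_conjugate X Y"
  shows "\<exists>i. \<forall>j\<ge>i. block_pattern (fact j) ` X \<subseteq> block_pattern (fact j) ` Y"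
proof -
  obtain r f g where c: "conjugating_codes r f g X Y"
    using conj topologically_conjugate_iff_codes[OF X Y] by blast
  \<comment> \<open>A hole in \<open>[-2r, 0)\<close> and one in \<open>[0, 2r)\<close> would be
    less than \<open>4 * r\<close> apart, so one of these intervals is free of holes.\<close>
  from separated_holes_far[OF toeplitz_separatedD(1,2)[OF X], of "4 * r"] obtain u where
    u: "u > 0" "\<forall>x\<in>X. \<forall>i\<in>holes u x. \<forall>j\<in>holes u x. i \<noteq> j \<longrightarrow> int (4 * r) < \<bar>i - j\<bar>"
    by (elim exE conjE)
  have "block_pattern (fact j) x \<in> block_pattern (fact j) ` Y" if "j \<ge> u" "x \<in> X" for j x
  proof -
    have "u dvd fact j" using u(1) that(1) by (simp add: dvd_fact)
    then have holes: "i \<in> holes u x" if "i \<notin> Per (fact j) x" for i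
      using that Per_dvd_mono[of u "fact j" x] by (auto simp: holes_def)
    have "\<exists>k. \<forall>i. min 0 (k - int r) \<le> i \<longrightarrow> i < max 0 (k + int r) \<longrightarrow> i \<in> Per (fact j) x"
    proof (cases "\<exists>h. 0 \<le> h \<and> h < 2 * int r \<and> h \<notin> Per (fact j) x")
      case True
      then obtain h where h: "0 \<le> h" "h < 2 * int r" "h \<notin> Per (fact j) x" by blast
      have "i \<in> Per (fact j) x" if "- 2 * int r \<le> i" "i < 0" for i
      proof (rule ccontr)
        assume "i \<notin> Per (fact j) x"
        then have "int (4 * r) < \<bar>h - i\<bar>"
          using u(2)[rule_format, OF \<open>x \<in> X\<close>, of h i] holes h that by simp
        then show False using h that by linarith
      qed
      \<comment> \<open>The offset \<open>- r\<close> needs exactly \<open>[-2r, 0)\<close> to be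
        free; the offset \<open>r\<close> of the other case needs \<open>[0, 2r)\<close>.\<close>
      then show ?thesis by (intro exI[of _ "- int r"]) auto
    next
      case False
      then show ?thesis by (intro exI[of _ "int r"]) auto
    qed
    then obtain k where
      k: "\<And>i. \<lbrakk>min 0 (k - int r) \<le> i; i < max 0 (k + int r)\<rbrakk> \<Longrightarrow> i \<in> Per (fact j) x"
      by blast
    have "apply_code r g (apply_code r f x) = x" "apply_code r f x \<in> Y"
      using c \<open>x \<in> X\<close> by (auto simp: conjugating_codes_def)
    then show ?thesis
      using block_pattern_apply_code[of k r "fact j" x g f, OF k] toeplitz_separatedD(7)[OF Y]
      by (metis imageI)
  qed
  then show ?thesis by blast
qed

text \<open>Finite truncations make this a countable conjunction of Borel conditions. Between
  compact sets nothing is lost, by \<open>same_patterns_realize\<close>.\<close>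

definition same_patterns :: "nat \<Rightarrow> (int \<Rightarrow> nat) set \<Rightarrow> (int \<Rightarrow> nat) set \<Rightarrow> bool" where
  "same_patterns p X Y \<longleftrightarrow>
     (\<forall>m. (\<lambda>x. block_pattern p x \<inter> square m) ` X = (\<lambda>y. block_pattern p y \<inter> square m) ` Y)"

lemma same_patternsI: "block_pattern p ` X = block_pattern p ` Y \<Longrightarrow> same_patterns p X Y"
  unfolding same_patterns_def using image_image[of "\<lambda>K. K \<inter> square _" "block_pattern p"] by metis

text \<open>The closed sets \<open>C m\<close> decrease and each meets \<open>Y\<close>, so by
  compactness one point of \<open>Y\<close> matches all truncations of the pattern of
  \<open>x\<close> at once.\<close>

lemma same_patterns_realize:
  assumes Y: "compact Y" and XY: "same_patterns p X Y" and x: "x \<in> X"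
  shows "\<exists>y\<in>Y. block_pattern p y = block_pattern p x"
proof -
  define C where "C m = {y. block_pattern p y \<inter> square m = block_pattern p x \<inter> square m}" for m
  have square_mono: "square k \<subseteq> square m" if "k \<le> m" for k m using that by (auto simp: square_def)
  have C_mono: "C m \<subseteq> C k" if "k \<le> m" for k m using square_mono[OF that] by (auto simp: C_def)
  have "Y \<inter> (\<Inter>m\<in>UNIV. C m) \<noteq> {}"
  proof (rule compact_imp_fip_image[OF Y])
    fix I' :: "nat set" assume "finite I'"
    define m where "m = Max (insert 0 I')"
    have "block_pattern p x \<inter> square m \<in> (\<lambda>y. block_pattern p y \<inter> square m) ` Y"
      using XY x unfolding same_patterns_def by (metis imageI)
    then obtain y where "y \<in> Y" "y \<in> C m" by (auto simp: C_def)
    moreover have "i \<le> m" if "i \<in> I'" for i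
      using that \<open>finite I'\<close> by (simp add: m_def)
    ultimately show "Y \<inter> (\<Inter>m\<in>I'. C m) \<noteq> {}" using C_mono by blast
  qed (auto simp: C_def intro: closed_finitary finitary_block_pattern)
  then obtain y where y: "y \<in> Y" "\<And>m. y \<in> C m" by blast
  have "(\<Union>m. square m) = UNIV"
  proof -
    have "(a, b) \<in> square (nat (\<bar>a\<bar> + \<bar>b\<bar>))" for a b :: int unfolding square_def by auto
    then show ?thesis by auto
  qed
  then have "block_pattern p y = block_pattern p x"
    using y(2) unfolding C_def by blast
  with y(1) show ?thesis by blast
qed

section \<open>Measurability\<close>

lemma pred_conjugate:
  "Measurable.pred (toeplitz_separated_borel n \<Otimes>\<^sub>M toeplitz_separated_borel n)
     (\<lambda>q. topologically_conjugate (fst q) (snd q))"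
proof -
  let ?M = "toeplitz_separated_borel n"
  let ?Q = "?M \<Otimes>\<^sub>M ?M"
  \<comment> \<open>The code maps \<open>X\<close> into \<open>Y\<close>, in the form of
    \<open>subset_closed_iff_windows\<close>.\<close>
  define sends where "sends r f X Y \<longleftrightarrow> (\<forall>m. \<forall>w\<in>words n m.
      (\<exists>x\<in>X. window m (apply_code r f x) 0 = w) \<longrightarrow> (\<exists>y\<in>Y. window m y 0 = w))" for r f X Y
  \<comment> \<open>A negated hit at coordinate 0; translation invariance of the subshift supplies
    the other coordinates.\<close>
  define fixes0 where "fixes0 r f g X \<longleftrightarrow>
      \<not> (\<exists>x\<in>X. apply_code r g (apply_code r f x) 0 \<noteq> x 0)" for r f g X
  have fin1: "finitary (\<lambda>x. window m (apply_code r f x) 0 = w)" for m r f w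
  proof (rule finitaryI)
    fix x y :: "int \<Rightarrow> nat" assume *: "\<forall>i\<in>{- int (m + r)..int (m + r)}. x i = y i"
    have "window m (apply_code r f x) 0 = window m (apply_code r f y) 0"
      unfolding window_eq_iff by (auto intro!: apply_code_local *[rule_format])
    then show "(window m (apply_code r f x) 0 = w) = (window m (apply_code r f y) 0 = w)" by simp
  qed simp
  have fin2: "finitary (\<lambda>y. window m y 0 = w)" for m w
    by (rule finitaryI[of "{- int m..int m}"]) (auto simp: window_def restrict_def fun_eq_iff)
  have fin3: "finitary (\<lambda>x. apply_code r g (apply_code r f x) 0 \<noteq> x 0)" for r f g
  proof (rule finitaryI)
    fix x y :: "int \<Rightarrow> nat" assume *: "\<forall>i\<in>{- int (r + r)..int (r + r)}. x i = y i"
    have "apply_code r g (apply_code r f x) 0 = apply_code r g (apply_code r f y) 0"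
      by (auto intro!: apply_code_local *[rule_format])
    moreover have "x 0 = y 0" using * by simp
    ultimately show "(apply_code r g (apply_code r f x) 0 \<noteq> x 0) =
        (apply_code r g (apply_code r f y) 0 \<noteq> y 0)" by simp
  qed simp
  have hit: "Measurable.pred ?Q (\<lambda>q. \<exists>x\<in>fst q. P x)" "Measurable.pred ?Q (\<lambda>q. \<exists>x\<in>snd q. P x)"
    if "finitary P" for P
    using measurable_compose[OF measurable_fst pred_hit[OF that]]
      measurable_compose[OF measurable_snd pred_hit[OF that]] by auto
  have sends: "Measurable.pred ?Q (\<lambda>q. sends r f (fst q) (snd q))"
    "Measurable.pred ?Q (\<lambda>q. sends r f (snd q) (fst q))" for r f
    unfolding sends_def
    by (intro pred_intros_countable pred_intros_finite finite_words pred_intros_logic hit fin1 fin2)+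
  have fixes0: "Measurable.pred ?Q (\<lambda>q. fixes0 r f g (fst q))"
    "Measurable.pred ?Q (\<lambda>q. fixes0 r f g (snd q))" for r f g
    unfolding fixes0_def by (intro pred_intros_logic hit fin3)+
  have eq: "topologically_conjugate X Y \<longleftrightarrow> (\<exists>r. \<exists>f\<in>codes n r. \<exists>g\<in>codes n r.
      sends r f X Y \<and> sends r g Y X \<and> fixes0 r f g X \<and> fixes0 r g f Y)"
    if X: "X \<in> toeplitz_separated n" and Y: "Y \<in> toeplitz_separated n" for X Y
  proof -
    have 1: "sends r f X Y \<longleftrightarrow> apply_code r f ` X \<subseteq> Y"
      if "f \<in> codes n r" "X \<in> toeplitz_separated n" "Y \<in> toeplitz_separated n" for r f X Y
    proof -
      have "apply_code r f ` X \<subseteq> full_shift n"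
        using apply_code_in_full_shift that toeplitz_separatedD(3) by blast
      from subset_closed_iff_windows[OF toeplitz_separatedD(6,7)[OF that(3)] this]
      show ?thesis by (simp add: sends_def)
    qed
    have 2: "fixes0 r f g X \<longleftrightarrow> (\<forall>x\<in>X. apply_code r g (apply_code r f x) = x)"
      if "X \<in> toeplitz_separated n" for r f g X
    proof (intro iffI ballI ext)
      fix x i assume *: "fixes0 r f g X" "x \<in> X"
      then have "apply_code r g (apply_code r f (translate i x)) 0 = translate i x 0"
        using toeplitz_separatedD(7)[OF that] by (auto simp: fixes0_def)
      then show "apply_code r g (apply_code r f x) i = x i"
        by (simp add: apply_code_translate) (simp add: translate_def)
    qed (simp add: fixes0_def)
    show ?thesis
      unfolding topologically_conjugate_iff_codes[OF X Y] conjugating_codes_def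
      using X Y by (simp add: 1 2 cong: bex_cong)
  qed
  have "topologically_conjugate (fst q) (snd q) \<longleftrightarrow> (\<exists>r. \<exists>f\<in>codes n r. \<exists>g\<in>codes n r.
      sends r f (fst q) (snd q) \<and> sends r g (snd q) (fst q) \<and>
      fixes0 r f g (fst q) \<and> fixes0 r g f (snd q))" if "q \<in> space ?Q" for q
    using that by (intro eq) (auto simp: space_pair_measure space_toeplitz_separated_borel)
  then show ?thesis
    by (subst measurable_cong) (assumption, intro pred_intros_countable pred_intros_finite
        finite_codes pred_intros_logic sends fixes0)
qed

text \<open>Applied with the finite set of all subsets of \<open>square m\<close> as
  \<open>U\<close>, this turns equality of images into finitely many equivalences between
  hits.\<close>

lemma image_eq_image_iff:
  fixes f :: "'a \<Rightarrow> 'c" and g :: "'b \<Rightarrow> 'c"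
  assumes "f ` X \<subseteq> U" "g ` Y \<subseteq> U"
  shows "f ` X = g ` Y \<longleftrightarrow> (\<forall>s\<in>U. (\<exists>x\<in>X. f x = s) \<longleftrightarrow> (\<exists>y\<in>Y. g y = s))"
proof -
  have "f ` X = g ` Y \<longleftrightarrow> (\<forall>s\<in>U. s \<in> f ` X \<longleftrightarrow> s \<in> g ` Y)" using assms by blast
  moreover have "s \<in> f ` X \<longleftrightarrow> (\<exists>x\<in>X. f x = s)" "s \<in> g ` Y \<longleftrightarrow> (\<exists>y\<in>Y. g y = s)" for s
    by auto
  ultimately show ?thesis by (simp only:)
qed

lemma pred_same_patterns:
  "Measurable.pred (toeplitz_separated_borel n \<Otimes>\<^sub>M toeplitz_separated_borel n)
     (\<lambda>q. same_patterns p (fst q) (snd q))"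
proof -
  let ?M = "toeplitz_separated_borel n"
  let ?Q = "?M \<Otimes>\<^sub>M ?M"
  have hit: "Measurable.pred ?Q (\<lambda>q. \<exists>x\<in>fst q. P x)" "Measurable.pred ?Q (\<lambda>q. \<exists>x\<in>snd q. P x)"
    if "finitary P" for P
    using measurable_compose[OF measurable_fst pred_hit[OF that]]
      measurable_compose[OF measurable_snd pred_hit[OF that]] by auto
  have eq: "same_patterns p X Y \<longleftrightarrow> (\<forall>m. \<forall>S\<in>Pow (square m).
      (\<exists>x\<in>X. block_pattern p x \<inter> square m = S) \<longleftrightarrow> (\<exists>y\<in>Y. block_pattern p y \<inter> square m = S))" for X Y
    unfolding same_patterns_def by (intro iff_allI image_eq_image_iff) auto
  have "finite (Pow (square m))" for m
    by (simp add: square_def)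
  then show ?thesis
    unfolding eq
    by (intro pred_intros_countable pred_intros_finite pred_intros_logic hit finitary_block_pattern)
qed

section \<open>Hyperfiniteness of conjugacy\<close>

lemma equiv_conjugacy_rel: "equiv (toeplitz_separated n) (conjugacy_rel n)"
proof (rule equivI)
  show "conjugacy_rel n \<subseteq> toeplitz_separated n \<times> toeplitz_separated n"
    by (auto simp: conjugacy_rel_def)
  have "topologically_conjugate X X" for X
    unfolding topologically_conjugate_def using homeomorphism_ident[of X] by metis
  then show "refl_on (toeplitz_separated n) (conjugacy_rel n)"
    by (auto simp: refl_on_def conjugacy_rel_def)
  show "sym (conjugacy_rel n)"
  \<comment> \<open>The definition of conjugacy states commutation for \<open>\<pi>\<close> alone;
    exchanging the two codes gives symmetry at once.\<close>
  proof (rule symI)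
    fix X Y assume "(X, Y) \<in> conjugacy_rel n"
    then have X: "X \<in> toeplitz_separated n" and Y: "Y \<in> toeplitz_separated n"
      and "topologically_conjugate X Y" by (auto simp: conjugacy_rel_def)
    then obtain r f g where "f \<in> codes n r" "g \<in> codes n r" "conjugating_codes r f g X Y"
      using topologically_conjugate_iff_codes[OF X Y] by blast
    moreover from this(3) have "conjugating_codes r g f Y X"
      by (simp add: conjugating_codes_def)
    ultimately show "(Y, X) \<in> conjugacy_rel n"
      using X Y topologically_conjugate_iff_codes[OF Y X] by (auto simp: conjugacy_rel_def)
  qed
  show "trans (conjugacy_rel n)"
  proof (rule transI)
    fix X Y Z assume "(X, Y) \<in> conjugacy_rel n" "(Y, Z) \<in> conjugacy_rel n"
    moreover from this obtain \<pi> \<rho> \<pi>' \<rho>' where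
      "homeomorphism X Y \<pi> \<rho>" "\<forall>x\<in>X. \<pi> (shift x) = shift (\<pi> x)"
      "homeomorphism Y Z \<pi>' \<rho>'" "\<forall>y\<in>Y. \<pi>' (shift y) = shift (\<pi>' y)"
      by (auto simp: conjugacy_rel_def topologically_conjugate_def)
    moreover from this have "homeomorphism X Z (\<pi>' \<circ> \<pi>) (\<rho> \<circ> \<rho>')"
      by (intro homeomorphism_compose)
    moreover from calculation have "\<forall>x\<in>X. (\<pi>' \<circ> \<pi>) (shift x) = shift ((\<pi>' \<circ> \<pi>) x)"
      by (auto simp: homeomorphism_def)
    ultimately show "(X, Z) \<in> conjugacy_rel n"
      unfolding conjugacy_rel_def topologically_conjugate_def by blast
  qed
qed

theorem theorem1p1:
  fixes n :: nat
  assumes "n \<ge> 2"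
  shows "hyperfinite (toeplitz_separated_borel n) (conjugacy_rel n)"
proof -
  let ?M = "toeplitz_separated_borel n"
  define F where "F i = {(X, Y) \<in> conjugacy_rel n. \<forall>j\<ge>i. same_patterns (fact j) X Y}" for i
  have F_iff: "(X, Y) \<in> F i \<longleftrightarrow>
      (X, Y) \<in> conjugacy_rel n \<and> (\<forall>j\<ge>i. same_patterns (fact j) X Y)" for i X Y
    by (simp add: F_def)
  have equiv: "equiv (toeplitz_separated n) (F i)" for i
  proof (rule equivI)
    note E = equivE[OF equiv_conjugacy_rel[of n]]
    show "F i \<subseteq> toeplitz_separated n \<times> toeplitz_separated n"
      by (auto simp: F_def conjugacy_rel_def)
    show "refl_on (toeplitz_separated n) (F i)"
      by (rule E) (simp add: refl_on_def F_iff same_patterns_def)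
    show "sym (F i)"
      by (rule E) (simp add: sym_def F_iff same_patterns_def)
    show "trans (F i)"
      by (rule E) (simp add: trans_def F_iff same_patterns_def, metis)
  qed
  have meas: "F i \<in> sets (?M \<Otimes>\<^sub>M ?M)" for i
  proof -
    have "Measurable.pred (?M \<Otimes>\<^sub>M ?M) (\<lambda>q. topologically_conjugate (fst q) (snd q) \<and>
        (\<forall>j\<in>{i..}. same_patterns (fact j) (fst q) (snd q)))"
      by (intro pred_intros_countable_bounded pred_intros_logic pred_conjugate pred_same_patterns)
    moreover have "F i = {q \<in> space (?M \<Otimes>\<^sub>M ?M). topologically_conjugate (fst q) (snd q) \<and>
        (\<forall>j\<in>{i..}. same_patterns (fact j) (fst q) (snd q))}"
      by (auto simp: F_def conjugacy_rel_def space_pair_measure space_toeplitz_separated_borel)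
    ultimately show ?thesis by (simp add: pred_def)
  qed
  have finite: "finite (F i `` {X})" if X: "X \<in> toeplitz_separated n" for i X
  proof -
    obtain x where x: "x \<in> X" using toeplitz_separatedD(4)[OF X] by blast
    let ?Z = "{z \<in> full_shift n. block_pattern (fact i) z = block_pattern (fact i) x}"
    \<comment> \<open>For one fixed \<open>x\<close> in \<open>X\<close>, each \<open>Y\<close> in
      the class has a point in the finite fibre \<open>?Z\<close> and is the orbit closure of that
      point.\<close>
    have "F i `` {X} \<subseteq> (\<lambda>z. closure (shift_orbit z)) ` ?Z"
    proof
      fix Y assume "Y \<in> F i `` {X}"
      then have Y: "Y \<in> toeplitz_separated n" and XY: "same_patterns (fact i) X Y"
        by (auto simp: F_iff conjugacy_rel_def)
      obtain y where y: "y \<in> Y" "block_pattern (fact i) y = block_pattern (fact i) x"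
        using same_patterns_realize[OF toeplitz_separatedD(5)[OF Y] XY x] by blast
      then have "y \<in> ?Z" using toeplitz_separatedD(3)[OF Y] by blast
      moreover have "Y = closure (shift_orbit y)"
        using toeplitz_subshift_minimal[OF toeplitz_separatedD(1)[OF Y] y(1)] .
      ultimately show "Y \<in> (\<lambda>z. closure (shift_orbit z)) ` ?Z" by blast
    qed
    moreover have "finite ?Z" using toeplitz_separatedD(3)[OF X] x by (intro finite_block_pattern_fibre) auto
    ultimately show ?thesis using finite_surj by blast
  qed
  have union: "conjugacy_rel n = (\<Union>i. F i)"
  proof (intro equalityI subsetI)
    fix q assume "q \<in> conjugacy_rel n"
    then obtain X Y where q: "q = (X, Y)" "(X, Y) \<in> conjugacy_rel n" by (cases q) auto
    then have "(Y, X) \<in> conjugacy_rel n"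
      using equiv_conjugacy_rel[of n] by (metis equivE symE)
    \<comment> \<open>Each inclusion of pattern sets has its own threshold; the larger one serves
      for both.\<close>
    with q(2) obtain k l where
      "\<And>j. j \<ge> k \<Longrightarrow> block_pattern (fact j) ` X \<subseteq> block_pattern (fact j) ` Y"
      "\<And>j. j \<ge> l \<Longrightarrow> block_pattern (fact j) ` Y \<subseteq> block_pattern (fact j) ` X"
      using conjugate_imp_block_patterns[of X n Y] conjugate_imp_block_patterns[of Y n X]
      unfolding conjugacy_rel_def by blast
    then have "same_patterns (fact j) X Y" if "j \<ge> max k l" for j
      using that by (intro same_patternsI equalityI) auto
    then have "q \<in> F (max k l)" using q by (simp add: F_iff)
    then show "q \<in> (\<Union>i. F i)" by blast
  qed (auto simp: F_def)
  have "F i \<subseteq> F (Suc i)" for i by (auto simp: F_def)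
  then show ?thesis
    unfolding hyperfinite_def finite_borel_equiv_def space_toeplitz_separated_borel
    using equiv meas finite union by blast
qed

end
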